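(* Let $a,c,e$ be indeterminates and define polynomials $T(n,k)\in\mathbb{Z}[a,c,e]$ for integers $n\ge 0$ and $k\in\mathbb{Z}$ by $T(0,k)=\delta_{k0}$ and, for $n\ge 1$, \[ T(n,k) \;=\; [a(n-k)+c]\,T(n-1,k-1) \;+\; e\,T(n-1,k). \] Then the lower-triangular matrix $\mathbf{T}=(T(n,k))_{n,k\ge 0}$ is coefficientwise totally positive in the indeterminates $a,c,e$.
   Context: This matrix is the specialisation $d=f=g=0$ of the matrix defined by $T(n,k)=[a(n-k)+c]T(n-1,k-1)+(dk+e)T(n-1,k)+[f(n-2)+g]T(n-2,k-1)$ with $T(0,k)=\delta_{k0}$, $T(-1,k)=0$. A (finite or infinite) matrix with entries in a polynomial ring $\mathbb{R}[\mathbf{x}]$ is called coefficientwise totally positive if every minor (determinant of a finite square submatrix) is a polynomial with nonnegative coefficients. *)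

theory Defs
  imports "HOL-Library.Poly_Mapping" "Jordan_Normal_Form.Determinant"
begin

text \<open>
  A polynomial in the indeterminates \<open>'x\<close> over \<open>'r\<close> is a finitely supported map from monomials
  (finitely supported exponent vectors) to coefficients; the library's multiplication on such
  maps is convolution, i.e. multiplication of polynomials.
\<close>

type_synonym ('x, 'r) mpoly = "('x \<Rightarrow>\<^sub>0 nat) \<Rightarrow>\<^sub>0 'r"

definition Var :: "'x \<Rightarrow> ('x, 'r::comm_ring_1) mpoly" where
  "Var x = Poly_Mapping.single (Poly_Mapping.single x 1) 1"

definition coeffs_nonneg :: "('x, 'r::linordered_idom) mpoly \<Rightarrow> bool" where
  "coeffs_nonneg p \<longleftrightarrow> (\<forall>m. 0 \<le> Poly_Mapping.lookup p m)"

text \<open>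
  The minor of an infinite matrix with rows \<open>I 0 < \<dots> < I (r - 1)\<close> and columns
  \<open>J 0 < \<dots> < J (r - 1)\<close>.
\<close>

definition minor :: "(nat \<Rightarrow> nat \<Rightarrow> 'p::comm_ring_1) \<Rightarrow> nat \<Rightarrow> (nat \<Rightarrow> nat) \<Rightarrow> (nat \<Rightarrow> nat) \<Rightarrow> 'p" where
  "minor M r I J = det (mat r r (\<lambda>(i, j). M (I i) (J j)))"

definition coefficientwise_TP :: "(nat \<Rightarrow> nat \<Rightarrow> ('x, 'r::linordered_idom) mpoly) \<Rightarrow> bool" where
  "coefficientwise_TP M \<longleftrightarrow>
     (\<forall>r I J. strict_mono_on {..<r} I \<longrightarrow> strict_mono_on {..<r} J \<longrightarrow> coeffs_nonneg (minor M r I J))"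

datatype indet = Ind_a | Ind_c | Ind_e

primrec T :: "nat \<Rightarrow> int \<Rightarrow> (indet, int) mpoly" where
  "T 0 k = (if k = 0 then 1 else 0)"
| "T (Suc n) k = (Var Ind_a * of_int (int (Suc n) - k) + Var Ind_c) * T n (k - 1) + Var Ind_e * T n k"

lemma T_lower_triangular: "k < 0 \<or> int n < k \<Longrightarrow> T n k = 0"
  by (induction n arbitrary: k) auto

definition T_matrix :: "nat \<Rightarrow> nat \<Rightarrow> (indet, int) mpoly" where
  "T_matrix n k = T n (int k)"

end

theory Submission
  imports Defs
begin

text \<open>
  Write \<open>R n m = T(n, n - m)\<close>, so that
  \<open>R (n + 1) (m + 1) = c * R n (m + 1) + e * R\<^sup>+ n m\<close>, where \<open>R\<^sup>+\<close> is \<open>R\<close> with \<open>c\<close> replaced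
  by \<open>c + a\<close>, i.e. the image of \<open>R\<close> under the Pascal matrix \<open>(binomial(n, j) * a^(n - j))\<close>.
  Hence \<open>T(n, k)\<close> counts weighted paths from a source at height \<open>n\<close> and time \<open>n\<close> down to a sink at
  height 0 and time \<open>k\<close>, in a planar network that repeats one strip (a Pascal network followed by
  steps of weight \<open>c\<close>) once per unit of time; each strip lowers the height by at least one, which keeps
  the sources on the outer boundary. The path matrix is built strip by strip from the identity, using
  only row operations that preserve total positivity: repeating a row, scaling a row by a
  nonnegative factor, and adding such a multiple of the next row to a row.
\<close>

section \<open>Polynomials with nonnegative coefficients\<close>

lemma coeffs_nonneg_0: "coeffs_nonneg 0"
  by (simp add: coeffs_nonneg_def)

lemma coeffs_nonneg_1: "coeffs_nonneg 1"
  by (simp add: coeffs_nonneg_def lookup_one when_def)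

lemma coeffs_nonneg_Var: "coeffs_nonneg (Var x)"
  by (simp add: coeffs_nonneg_def Var_def lookup_single when_def)

lemma coeffs_nonneg_add: "coeffs_nonneg p \<Longrightarrow> coeffs_nonneg q \<Longrightarrow> coeffs_nonneg (p + q)"
  by (simp add: coeffs_nonneg_def lookup_add)

lemma coeffs_nonneg_mult:
  assumes "coeffs_nonneg p" "coeffs_nonneg q"
  shows "coeffs_nonneg (p * q)"
  using assms
  by (auto simp: coeffs_nonneg_def lookup_mult Sum_any.expand_set when_def
      intro!: sum_nonneg mult_nonneg_nonneg)

lemma coeffs_nonneg_prod: "(\<And>i. i \<in> A \<Longrightarrow> coeffs_nonneg (f i)) \<Longrightarrow> coeffs_nonneg (prod f A)"
  by (induction A rule: infinite_finite_induct) (auto intro: coeffs_nonneg_1 coeffs_nonneg_mult)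

section \<open>Row operations preserving total positivity\<close>

lemma det_row_linear:
  fixes A :: "nat \<Rightarrow> nat \<Rightarrow> 'a::comm_ring_1"
  assumes "l < r"
  shows "det (mat r r (\<lambda>(i, j). if i = l then u j + x * w j else A i j)) =
    det (mat r r (\<lambda>(i, j). if i = l then u j else A i j)) +
    x * det (mat r r (\<lambda>(i, j). if i = l then w j else A i j))"
proof -
  define M where "M v = mat r r (\<lambda>(i, j). if i = l then v j else A i j)" for v
  have "mat_delete (M v) l j = mat_delete (M v') l j" for v v' j
    using assms by (intro eq_matI) (auto simp: mat_delete_def M_def)
  then have cof: "cofactor (M v) l j = cofactor (M (\<lambda>_. 0)) l j" for v j
    unfolding cofactor_def by metis
  have "det (M v) = (\<Sum>j<r. v j * cofactor (M (\<lambda>_. 0)) l j)" for v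
    using laplace_expansion_row[of "M v" r l] assms by (simp add: cof[of v]) (simp add: M_def)
  then have "det (M (\<lambda>j. u j + x * w j)) = det (M u) + x * det (M w)"
    by (simp add: algebra_simps sum.distrib sum_distrib_left)
  then show ?thesis by (simp add: M_def)
qed

lemma minor_cong:
  assumes "\<And>i j. i < r \<Longrightarrow> j < r \<Longrightarrow> M (I i) (J j) = M' (I' i) (J' j)"
  shows "minor M r I J = minor M' r I' J'"
  unfolding minor_def using assms by (intro arg_cong[of _ _ det] eq_matI) auto

lemma minor_scale_rows: "minor (\<lambda>i j. d i * M i j) r I J = (\<Prod>i<r. d (I i)) * minor M r I J"
proof -
  have 1: "minor (\<lambda>i j. d i * M i j) r I J =
      det (mat\<^sub>r r r (\<lambda>i. d (I i) \<cdot>\<^sub>v vec r (\<lambda>j. M (I i) (J j))))"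
    unfolding minor_def by (intro arg_cong[of _ _ det] eq_matI) auto
  have 2: "minor M r I J = det (mat\<^sub>r r r (\<lambda>i. vec r (\<lambda>j. M (I i) (J j))))"
    unfolding minor_def by (intro arg_cong[of _ _ det] eq_matI) auto
  show ?thesis
    unfolding 1 2 by (subst det_rows_mul) (auto simp: lessThan_atLeast0)
qed

lemma minor_eq_0_rows:
  assumes "i < i'" "i' < r" "\<And>j. M (I i) j = M (I i') j"
  shows "minor M r I J = 0"
  unfolding minor_def using assms
  by (intro det_identical_rows[of _ r i i']) (auto simp: row_def)

lemma coefficientwise_TP_scale_rows:
  assumes "coefficientwise_TP M" "\<And>i. coeffs_nonneg (d i)"
  shows "coefficientwise_TP (\<lambda>i j. d i * M i j)"
  using assms unfolding coefficientwise_TP_def minor_scale_rows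
  by (auto intro!: coeffs_nonneg_mult coeffs_nonneg_prod)

text \<open>If \<open>f\<close> merges two chosen rows, the minor vanishes; otherwise it is a minor
  of \<open>M\<close>.\<close>

lemma coefficientwise_TP_reindex:
  assumes "coefficientwise_TP M" "mono f"
  shows "coefficientwise_TP (\<lambda>i. M (f i))"
  unfolding coefficientwise_TP_def
proof (intro allI impI)
  fix r :: nat and I J :: "nat \<Rightarrow> nat"
  assume I: "strict_mono_on {..<r} I" and J: "strict_mono_on {..<r} J"
  have eq: "minor (\<lambda>i. M (f i)) r I J = minor M r (f \<circ> I) J"
    by (simp add: minor_def)
  show "coeffs_nonneg (minor (\<lambda>i. M (f i)) r I J)"
  proof (cases "strict_mono_on {..<r} (f \<circ> I)")
    case True
    then show ?thesis
      using assms(1) J unfolding eq coefficientwise_TP_def by blast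
  next
    case False
    then obtain i i' where i: "i < i'" "i' < r" "\<not> f (I i) < f (I i')"
      unfolding strict_mono_on_def by auto
    then have "I i < I i'"
      using strict_mono_onD[OF I, of i i'] by simp
    then have "f (I i) = f (I i')"
      using monoD[OF \<open>mono f\<close>, of "I i" "I i'"] i(3) by simp
    with i have "minor M r (f \<circ> I) J = 0"
      by (intro minor_eq_0_rows[of i i']) auto
    then show ?thesis
      unfolding eq by (simp add: coeffs_nonneg_0)
  qed
qed

text \<open>A minor using row \<open>s\<close> is linear in it; replacing row \<open>s\<close> by
  row \<open>Suc s\<close> is a monotone reindexing.\<close>

lemma coefficientwise_TP_add_row:
  assumes M: "coefficientwise_TP M" and x: "coeffs_nonneg x"
  shows "coefficientwise_TP (M(s := \<lambda>j. M s j + x * M (Suc s) j))"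
  unfolding coefficientwise_TP_def
proof (intro allI impI)
  fix r :: nat and I J :: "nat \<Rightarrow> nat"
  assume I: "strict_mono_on {..<r} I" and J: "strict_mono_on {..<r} J"
  let ?M = "M(s := \<lambda>j. M s j + x * M (Suc s) j)"
  have TP: "coeffs_nonneg (minor M' r I J)" if "coefficientwise_TP M'" for M' :: "nat \<Rightarrow> nat \<Rightarrow> ('a, 'b) mpoly"
    using that I J unfolding coefficientwise_TP_def by blast
  show "coeffs_nonneg (minor ?M r I J)"
  proof (cases "\<exists>l<r. I l = s")
    case True
    then obtain l where l: "l < r" "I l = s" by blast
    have inj: "I i = s \<longleftrightarrow> i = l" if "i < r" for i
      using strict_mono_on_imp_inj_on[OF I] l that by (auto dest: inj_onD)
    let ?f = "\<lambda>i. if i = s then Suc s else i"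
    have "minor ?M r I J = minor M r I J + x * minor (\<lambda>i. M (?f i)) r I J"
    proof -
      have 1: "minor ?M r I J = det (mat r r (\<lambda>(i, j). if i = l then M s (J j) + x * M (Suc s) (J j) else M (I i) (J j)))"
        unfolding minor_def using inj l by (intro arg_cong[of _ _ det] eq_matI) auto
      have 2: "minor M r I J = det (mat r r (\<lambda>(i, j). if i = l then M s (J j) else M (I i) (J j)))"
        unfolding minor_def using inj l by (intro arg_cong[of _ _ det] eq_matI) auto
      have 3: "minor (\<lambda>i. M (?f i)) r I J = det (mat r r (\<lambda>(i, j). if i = l then M (Suc s) (J j) else M (I i) (J j)))"
        unfolding minor_def using inj l by (intro arg_cong[of _ _ det] eq_matI) auto
      show ?thesis unfolding 1 2 3 by (rule det_row_linear[OF l(1)])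
    qed
    moreover have "mono ?f"
      by (auto simp: mono_def)
    ultimately show ?thesis
      using M x by (auto intro!: coeffs_nonneg_add coeffs_nonneg_mult TP coefficientwise_TP_reindex)
  next
    case False
    then have "minor ?M r I J = minor M r I J"
      by (intro minor_cong) auto
    then show ?thesis using TP[OF M] by simp
  qed
qed

lemma coefficientwise_TP_add_rows:
  assumes M: "coefficientwise_TP M" and w: "\<And>i. coeffs_nonneg (w i)"
  shows "coefficientwise_TP (\<lambda>i j. M i j + w i * M (Suc i) j)"
  unfolding coefficientwise_TP_def
proof (intro allI impI)
  fix r :: nat and I J :: "nat \<Rightarrow> nat"
  assume I: "strict_mono_on {..<r} I" and J: "strict_mono_on {..<r} J"
  \<comment> \<open>Rows change in increasing order, so row \<open>Suc s\<close> is still the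
    original one when added to row \<open>s\<close>.\<close>
  define N where "N s = (\<lambda>i j. if i < s then M i j + w i * M (Suc i) j else M i j)" for s
  have N: "coefficientwise_TP (N s)" for s
  proof (induction s)
    case 0
    then show ?case using M by (simp add: N_def)
  next
    case (Suc s)
    have "N (Suc s) = (N s)(s := \<lambda>j. N s s j + w s * N s (Suc s) j)"
      by (auto simp: N_def fun_eq_iff less_Suc_eq)
    then show ?case
      using coefficientwise_TP_add_row[OF Suc w] by metis
  qed
  have "minor (\<lambda>i j. M i j + w i * M (Suc i) j) r I J = minor (N (Suc (Max (I ` {..<r})))) r I J"
    by (intro minor_cong) (auto simp: N_def less_Suc_eq_le)
  then show "coeffs_nonneg (minor (\<lambda>i j. M i j + w i * M (Suc i) j) r I J)"
    using N I J unfolding coefficientwise_TP_def by simp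
qed

lemma det_zero_row:
  fixes A :: "'a::comm_ring_1 mat"
  assumes "A \<in> carrier_mat r r" "i < r" "\<And>j. j < r \<Longrightarrow> A $$ (i, j) = 0"
  shows "det A = 0"
  using laplace_expansion_row[OF assms(1,2)] assms(3) by simp

lemma det_zero_column:
  fixes A :: "'a::comm_ring_1 mat"
  assumes "A \<in> carrier_mat r r" "j < r" "\<And>i. i < r \<Longrightarrow> A $$ (i, j) = 0"
  shows "det A = 0"
  using laplace_expansion_column[OF assms(1,2)] assms(3) by simp

text \<open>Where \<open>I\<close> and \<open>J\<close> first differ, the smaller value is missed by
  the other sequence: a zero row or column.\<close>

lemma coefficientwise_TP_identity: "coefficientwise_TP (\<lambda>i j. if i = j then 1 else 0)"
  unfolding coefficientwise_TP_def
proof (intro allI impI)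
  fix r :: nat and I J :: "nat \<Rightarrow> nat"
  assume I: "strict_mono_on {..<r} I" and J: "strict_mono_on {..<r} J"
  let ?A = "mat r r (\<lambda>(i, j). if I i = J j then 1 else 0) :: ('a, 'b) mpoly mat"
  have "coeffs_nonneg (det ?A)"
  proof (cases "\<exists>i<r. I i \<noteq> J i")
    case True
    define l where "l = (LEAST i. i < r \<and> I i \<noteq> J i)"
    have l: "l < r" "I l \<noteq> J l"
      using LeastI_ex[OF True] by (auto simp: l_def)
    have less: "I i = J i" if "i < l" for i
      using not_less_Least[OF that[unfolded l_def]] that l(1) by auto
    have "det ?A = 0"
    proof (cases "I l < J l")
      case True
      have "I l \<noteq> J j" if "j < r" for j
        using strict_mono_onD[OF I, of j l] strict_mono_onD[OF J, of l j] less[of j] l that True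
        by (cases j l rule: linorder_cases) auto
      then show ?thesis
        using l by (intro det_zero_row[of _ r l]) auto
    next
      case False
      have "I i \<noteq> J l" if "i < r" for i
        using strict_mono_onD[OF J, of i l] strict_mono_onD[OF I, of l i] less[of i] l that False
        by (cases i l rule: linorder_cases) auto
      then show ?thesis
        using l by (intro det_zero_column[of _ r l]) auto
    qed
    then show ?thesis by (simp add: coeffs_nonneg_0)
  next
    case False
    then have "?A = 1\<^sub>m r"
      using strict_mono_on_imp_inj_on[OF J] by (intro eq_matI) (auto dest: inj_onD)
    then show ?thesis by (simp add: coeffs_nonneg_1)
  qed
  then show "coeffs_nonneg (minor (\<lambda>i j. if i = j then (1 :: ('a, 'b) mpoly) else 0) r I J)"
    by (simp add: minor_def)
qed

section \<open>The shifted rows of the triangle\<close>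

text \<open>The triangle read from the diagonal; the second index counts the factors of \<open>e\<close>.\<close>

definition R :: "nat \<Rightarrow> int \<Rightarrow> (indet, int) mpoly" where
  "R n m = T n (int n - m)"

lemma R_0: "R 0 m = (if m = 0 then 1 else 0)"
  by (simp add: R_def)

lemma R_Suc: "R (Suc n) m = (Var Ind_a * of_int m + Var Ind_c) * R n m + Var Ind_e * R n (m - 1)"
  by (simp add: R_def algebra_simps)

text \<open>
  In the variable \<open>n\<close> of \<open>R n m\<close> this applies \<open>p\<close> times the operator (unit shift) + \<open>a\<close>.
  Hence \<open>R_shift n 0 m\<close> is the binomial transform of \<open>R\<close>, which is \<open>R n m\<close> with \<open>c\<close> replaced
  by \<open>c + a\<close>.
\<close>

primrec R_shift :: "nat \<Rightarrow> nat \<Rightarrow> int \<Rightarrow> (indet, int) mpoly" where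
  "R_shift 0 q m = R q m"
| "R_shift (Suc p) q m = R_shift p (Suc q) m + Var Ind_a * R_shift p q m"

lemma R_shift_Suc:
  "R_shift p (Suc q) m =
    (Var Ind_a * of_int m + Var Ind_c) * R_shift p q m + Var Ind_e * R_shift p q (m - 1)"
  by (induction p arbitrary: q) (simp_all add: R_Suc algebra_simps)

text \<open>The extra \<open>a\<close> in \<open>R_shift (Suc n)\<close> turns
  \<open>a * m + c\<close> into \<open>a * (m + 1) + c\<close>, so both sides obey one recurrence in
  \<open>n\<close>.\<close>

lemma R_Suc_eq_R_shift: "R (Suc n) (m + 1) = Var Ind_c * R n (m + 1) + Var Ind_e * R_shift n 0 m"
proof (induction n arbitrary: m)
  case 0
  show ?case by (cases "m = - 1") (auto simp: R_Suc R_0)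
next
  case (Suc n)
  have "R (Suc (Suc n)) (m + 1) =
      (Var Ind_a * of_int (m + 1) + Var Ind_c) * R (Suc n) (m + 1) + Var Ind_e * R (Suc n) (m - 1 + 1)"
    by (subst R_Suc) simp
  also have "\<dots> = (Var Ind_a * of_int (m + 1) + Var Ind_c) *
        (Var Ind_c * R n (m + 1) + Var Ind_e * R_shift n 0 m) +
      Var Ind_e * (Var Ind_c * R n m + Var Ind_e * R_shift n 0 (m - 1))"
    by (simp only: Suc) simp
  also have "\<dots> = Var Ind_c * R (Suc n) (m + 1) + Var Ind_e * R_shift (Suc n) 0 m"
    by (simp add: R_Suc R_shift_Suc algebra_simps)
  finally show ?case .
qed

section \<open>Path matrices, strip by strip\<close>

text \<open>
  Path matrix after \<open>t\<close> strips: the rows of the sources \<open>0, \<dots>, t - 1\<close> already passed, then the rows of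
  the heights \<open>t, \<dots>, 0\<close> at time \<open>t\<close>, then unit vectors for the sinks not yet reached.
\<close>

definition stage :: "nat \<Rightarrow> nat \<Rightarrow> nat \<Rightarrow> (indet, int) mpoly" where
  "stage t i k =
    (if i < t then T_matrix i k
     else if i \<le> 2 * t then R (2 * t - i) (int t - int k)
     else if i = k + t then 1 else 0)"

text \<open>
  The same matrix within a strip, after source \<open>t\<close> has been split off from the row of height \<open>t\<close>;
  \<open>f h m\<close> is the current entry at height \<open>h\<close> and column \<open>t - m\<close>.
\<close>

definition block :: "nat \<Rightarrow> (nat \<Rightarrow> int \<Rightarrow> (indet, int) mpoly) \<Rightarrow> nat \<Rightarrow> nat \<Rightarrow> (indet, int) mpoly" where
  "block t f i k =
    (if i \<le> t then T_matrix i k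
     else if i \<le> 2 * t + 1 then f (2 * t + 1 - i) (int t - int k)
     else if i = k + t + 1 then 1 else 0)"

lemma stage_0: "stage 0 = (\<lambda>i j. if i = j then 1 else 0)"
  by (auto simp: stage_def R_0 fun_eq_iff)

lemma block_cong: "(\<And>h m. h \<le> t \<Longrightarrow> f h m = g h m) \<Longrightarrow> block t f = block t g"
  by (auto simp: block_def fun_eq_iff)

text \<open>Row \<open>t\<close> of \<open>stage t\<close> serves both as source \<open>t\<close>
  and as height \<open>t\<close>, so it is repeated.\<close>

lemma block_R: "block t R = (\<lambda>i. stage t (if i \<le> t then i else i - 1))"
proof (intro ext)
  fix i k
  have "R t (int t - int k) = T_matrix t k"
    by (simp add: R_def T_matrix_def)
  moreover have "2 * t - (i - 1) = 2 * t + 1 - i" if "\<not> i \<le> t"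
    using that by simp
  ultimately show "block t R i k = stage t (if i \<le> t then i else i - 1) k"
    by (auto simp: block_def stage_def mult_2)
qed

lemma block_R_Suc: "block t (\<lambda>h m. R (Suc h) (m + 1)) = stage (Suc t)"
proof (intro ext)
  fix i k
  consider "i \<le> t" | "t < i" "i \<le> 2 * t + 1" | "i = 2 * t + 2" | "2 * t + 2 < i"
    by linarith
  then show "block t (\<lambda>h m. R (Suc h) (m + 1)) i k = stage (Suc t) i k"
  proof cases
    case 2
    then have "Suc (2 * t + 1 - i) = 2 * Suc t - i" "int t - int k + 1 = int (Suc t) - int k"
      by auto
    with 2 show ?thesis by (simp add: block_def stage_def algebra_simps)
  \<comment> \<open>The unit row of sink \<open>t + 1\<close> becomes the row of height 0.\<close>
  qed (auto simp: block_def stage_def R_0)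
qed

text \<open>Pascal's matrix as a product of bidiagonal ones: the \<open>p\<close>-th factor only affects heights \<open>\<ge> p\<close>.\<close>

lemma coefficientwise_TP_block_R_shift:
  assumes "coefficientwise_TP (block t R)"
  shows "coefficientwise_TP (block t (\<lambda>h. R_shift (min p h) (h - min p h)))"
proof (induction p)
  case 0
  have "(\<lambda>h. R_shift (min 0 h) (h - min 0 h)) = R"
    by (simp add: fun_eq_iff)
  then show ?case using assms by simp
next
  case (Suc p)
  let ?M = "block t (\<lambda>h. R_shift (min p h) (h - min p h))"
  \<comment> \<open>Row \<open>i\<close> has height \<open>2 * t + 1 - i\<close>; the second
    condition says that it exceeds \<open>p\<close>.\<close>
  define w where "w i = (if t < i \<and> i + p \<le> 2 * t then Var Ind_a else 0 :: (indet, int) mpoly)" for i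
  have "block t (\<lambda>h. R_shift (min (Suc p) h) (h - min (Suc p) h)) i k =
      ?M i k + w i * ?M (Suc i) k" for i k
  proof (cases "t < i \<and> i + p \<le> 2 * t")
    case True
    define q where "q = 2 * t - i - p"
    have "2 * t + 1 - i = Suc (p + q)" "2 * t + 1 - Suc i = p + q"
      using True by (auto simp: q_def)
    with True show ?thesis by (simp add: block_def w_def)
  next
    case False
    then have "min (Suc p) (2 * t + 1 - i) = min p (2 * t + 1 - i)" if "t < i"
      using that by auto
    with False show ?thesis by (auto simp: block_def w_def)
  qed
  moreover have "coefficientwise_TP (\<lambda>i k. ?M i k + w i * ?M (Suc i) k)"
    using Suc by (rule coefficientwise_TP_add_rows) (simp add: w_def coeffs_nonneg_Var coeffs_nonneg_0)
  ultimately show ?case by presburger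
qed

text \<open>Steps of weight \<open>c\<close> are added from height 0 upwards, so the next row is
  already final; below height 0 it is the unit row of sink \<open>t + 1\<close>.\<close>

lemma coefficientwise_TP_block_R_Suc:
  assumes "coefficientwise_TP (block t (\<lambda>h m. Var Ind_e * R_shift h 0 m))" "s \<le> Suc t"
  shows "coefficientwise_TP
    (block t (\<lambda>h m. if h < s then R (Suc h) (m + 1) else Var Ind_e * R_shift h 0 m))"
  using assms(2)
proof (induction s)
  case 0
  then show ?case using assms(1) by simp
next
  case (Suc s)
  define f where "f s h m = (if h < s then R (Suc h) (m + 1) else Var Ind_e * R_shift h 0 m)" for s h m
  let ?M = "block t (f s)"
  let ?l = "2 * t + 1 - s"
  have below: "?M (Suc ?l) k = R s (int t - int k + 1)" for k
  proof (cases s)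
    case 0
    then show ?thesis by (auto simp: block_def R_0)
  next
    case (Suc s')
    then have "2 * t + 1 - Suc ?l = s'" "\<not> Suc ?l \<le> t" "Suc ?l \<le> 2 * t + 1"
      using Suc.prems by auto
    then show ?thesis by (simp add: block_def f_def Suc)
  qed
  have l: "t < ?l" "?l \<le> 2 * t + 1" "2 * t + 1 - ?l = s"
    using Suc.prems by auto
  have "block t (f (Suc s)) i k = (?M(?l := \<lambda>k. ?M ?l k + Var Ind_c * ?M (Suc ?l) k)) i k" for i k
  proof (cases "i = ?l")
    case True
    then show ?thesis
      unfolding below using l by (simp add: block_def f_def R_Suc_eq_R_shift)
  next
    case False
    then have "2 * t + 1 - i \<noteq> s" if "i \<le> 2 * t + 1"
      using that by auto
    with False show ?thesis
      by (auto simp: block_def f_def less_Suc_eq)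
  qed
  then have "block t (f (Suc s)) = ?M(?l := \<lambda>k. ?M ?l k + Var Ind_c * ?M (Suc ?l) k)"
    by blast
  moreover have "coefficientwise_TP ?M"
    using Suc by (simp add: f_def[abs_def])
  ultimately have "coefficientwise_TP (block t (f (Suc s)))"
    using coefficientwise_TP_add_row[OF _ coeffs_nonneg_Var] by simp
  then show ?case by (simp add: f_def[abs_def])
qed

lemma coefficientwise_TP_stage: "coefficientwise_TP (stage t)"
proof (induction t)
  case 0
  show ?case unfolding stage_0 by (rule coefficientwise_TP_identity)
next
  case (Suc t)
  have "coefficientwise_TP (block t R)"
    unfolding block_R using Suc by (rule coefficientwise_TP_reindex) (auto simp: mono_def)
  then have "coefficientwise_TP (block t (\<lambda>h. R_shift (min t h) (h - min t h)))"
    by (rule coefficientwise_TP_block_R_shift)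
  also have "block t (\<lambda>h. R_shift (min t h) (h - min t h)) = block t (\<lambda>h. R_shift h 0)"
    by (rule block_cong) (simp add: min_def)
  finally have "coefficientwise_TP
      (\<lambda>i k. (if t < i \<and> i \<le> 2 * t + 1 then Var Ind_e else 1) * block t (\<lambda>h. R_shift h 0) i k)"
    by (rule coefficientwise_TP_scale_rows) (simp add: coeffs_nonneg_Var coeffs_nonneg_1)
  also have "(\<lambda>i k. (if t < i \<and> i \<le> 2 * t + 1 then Var Ind_e else 1) * block t (\<lambda>h. R_shift h 0) i k) =
      block t (\<lambda>h m. Var Ind_e * R_shift h 0 m)"
    by (auto simp: block_def fun_eq_iff)
  finally have "coefficientwise_TP (block t
      (\<lambda>h m. if h < Suc t then R (Suc h) (m + 1) else Var Ind_e * R_shift h 0 m))"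
    by (rule coefficientwise_TP_block_R_Suc) simp
  also have "block t (\<lambda>h m. if h < Suc t then R (Suc h) (m + 1) else Var Ind_e * R_shift h 0 m) =
      block t (\<lambda>h m. R (Suc h) (m + 1))"
    by (rule block_cong) simp
  finally show ?case
    unfolding block_R_Suc .
qed

theorem theorem1p5: "coefficientwise_TP T_matrix"
  unfolding coefficientwise_TP_def
proof (intro allI impI)
  fix r :: nat and I J :: "nat \<Rightarrow> nat"
  assume I: "strict_mono_on {..<r} I" and J: "strict_mono_on {..<r} J"
  \<comment> \<open>After enough strips all chosen sources have been passed.\<close>
  have "minor T_matrix r I J = minor (stage (Suc (Max (I ` {..<r})))) r I J"
    by (intro minor_cong) (simp add: stage_def less_Suc_eq_le)
  then show "coeffs_nonneg (minor T_matrix r I J)"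
    using coefficientwise_TP_stage I J unfolding coefficientwise_TP_def by simp
qed

end
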